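(* Let $H$ be a forest on at most $4$ vertices that is not isomorphic to $K_{1,3}$. Then every $H$-free graph $G$ satisfies $\chi(G)\le r(G)+1$. If, additionally, $H$ is not isomorphic to $2K_2$ or to $K_2+2K_1$, then every $H$-free graph is path-perfect.
   Context: All graphs are finite, simple, undirected and loopless. $\chi(G)$ is the chromatic number of $G$. A graph is $H$-free if it has no induced subgraph isomorphic to $H$. $G+H$ denotes disjoint union and $\ell G$ denotes the disjoint union of $\ell$ copies of $G$. A path in $G$ is a (not necessarily induced) subgraph of $G$ that is a path. For a graph $G$, $r(G)$ denotes the maximum of $\chi(G[V(P)])$ over all paths $P$ in $G$, where $G[V(P)]$ is the subgraph of $G$ induced by the vertex set of $P$. A graph $G$ is path-perfect if every induced subgraph $G'$ of $G$ satisfies $\chi(G')=r(G')$. *)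

theory Defs
  imports Main
begin

record 'a sgraph =
  verts :: "'a set"
  edges :: "'a set set"

definition simple_graph :: "'a sgraph \<Rightarrow> bool" where
  "simple_graph G \<longleftrightarrow> finite (verts G) \<and> (\<forall>e\<in>edges G. e \<subseteq> verts G \<and> card e = 2)"

definition adj :: "'a sgraph \<Rightarrow> 'a \<Rightarrow> 'a \<Rightarrow> bool" where
  "adj G u v \<longleftrightarrow> {u, v} \<in> edges G"

definition induced :: "'a sgraph \<Rightarrow> 'a set \<Rightarrow> 'a sgraph" where
  "induced G S = \<lparr>verts = S, edges = {e \<in> edges G. e \<subseteq> S}\<rparr>"

definition iso :: "'a sgraph \<Rightarrow> 'b sgraph \<Rightarrow> bool"  (infix "\<simeq>" 50) where
  "G \<simeq> H \<longleftrightarrow> (\<exists>f. bij_betw f (verts G) (verts H) \<and>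
     (\<forall>u\<in>verts G. \<forall>v\<in>verts G. adj G u v \<longleftrightarrow> adj H (f u) (f v)))"

definition induced_free :: "'b sgraph \<Rightarrow> 'a sgraph \<Rightarrow> bool" where
  "induced_free H G \<longleftrightarrow> \<not> (\<exists>S\<subseteq>verts G. induced G S \<simeq> H)"

definition proper_coloring :: "'a sgraph \<Rightarrow> ('a \<Rightarrow> nat) \<Rightarrow> nat \<Rightarrow> bool" where
  "proper_coloring G c k \<longleftrightarrow>
     c ` verts G \<subseteq> {..<k} \<and> (\<forall>u\<in>verts G. \<forall>v\<in>verts G. adj G u v \<longrightarrow> c u \<noteq> c v)"

definition chromatic_number :: "'a sgraph \<Rightarrow> nat"  ("\<chi>") where
  "\<chi> G = (LEAST k. \<exists>c. proper_coloring G c k)"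

text \<open>A path is given by the sequence of its vertices.  The empty sequence is admitted; it
  only matters for the graph without vertices, where it makes the maximum below well defined
  (with value 0).\<close>

definition path_in :: "'a sgraph \<Rightarrow> 'a list \<Rightarrow> bool" where
  "path_in G p \<longleftrightarrow> set p \<subseteq> verts G \<and> distinct p \<and> successively (adj G) p"

definition path_chromatic :: "'a sgraph \<Rightarrow> nat"  ("\<r>") where
  "\<r> G = Max {\<chi> (induced G (set p)) | p. path_in G p}"

definition path_perfect :: "'a sgraph \<Rightarrow> bool" where
  "path_perfect G \<longleftrightarrow> (\<forall>S\<subseteq>verts G. \<chi> (induced G S) = \<r> (induced G S))"

definition cycle_in :: "'a sgraph \<Rightarrow> 'a list \<Rightarrow> bool" where
  "cycle_in G p \<longleftrightarrow> path_in G p \<and> length p \<ge> 3 \<and> adj G (last p) (hd p)"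

definition forest :: "'a sgraph \<Rightarrow> bool" where
  "forest G \<longleftrightarrow> simple_graph G \<and> \<not> (\<exists>p. cycle_in G p)"

definition complete_graph :: "nat \<Rightarrow> nat sgraph" where
  "complete_graph n = \<lparr>verts = {..<n}, edges = {{i, j} | i j. i < n \<and> j < n \<and> i \<noteq> j}\<rparr>"

definition complete_bipartite :: "nat \<Rightarrow> nat \<Rightarrow> (nat + nat) sgraph" where
  "complete_bipartite m n = \<lparr>verts = {..<m} <+> {..<n},
     edges = {{Inl i, Inr j} | i j. i < m \<and> j < n}\<rparr>"

definition disjoint_union :: "'a sgraph \<Rightarrow> 'b sgraph \<Rightarrow> ('a + 'b) sgraph"  (infixl "\<uplus>" 65) where
  "G \<uplus> H = \<lparr>verts = verts G <+> verts H,
     edges = (image Inl) ` edges G \<union> (image Inr) ` edges H\<rparr>"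

definition copies :: "nat \<Rightarrow> 'a sgraph \<Rightarrow> (nat \<times> 'a) sgraph" where
  "copies l G = \<lparr>verts = {..<l} \<times> verts G,
     edges = {Pair i ` e | i e. i < l \<and> e \<in> edges G}\<rparr>"

end

theory Submission
  imports Defs "HOL-Combinatorics.Transposition"
begin

text \<open>
  If an induced subgraph \<open>F\<close> of \<open>H\<close> is missing from a graph, then so is \<open>H\<close>. Every forest on at most three
  vertices is an induced subgraph of \<open>4K\<^sub>1\<close> or of \<open>P\<^sub>4\<close>, and the forests on four vertices other
  than \<open>K\<^sub>1\<^sub>,\<^sub>3\<close> are \<open>4K\<^sub>1\<close>, \<open>K\<^sub>2 + 2K\<^sub>1\<close>, \<open>2K\<^sub>2\<close>, \<open>P\<^sub>3 + K\<^sub>1\<close> and \<open>P\<^sub>4\<close>. So there are five classes of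
  graphs to study (\<open>induced_free_cases\<close>), all closed under induced subgraphs. In each one the aim is to
  color a vertex set with \<open>k\<close> colors, or with \<open>k + 1\<close>, when every path in it spans a \<open>k\<close>-colorable
  graph.

  \<^item> \<open>2K\<^sub>2\<close>-free: the vertices off a longest path \<open>p\<close> are independent, since an edge \<open>xy\<close> off \<open>p\<close> must
    see the first edge of \<open>p\<close>, and then replacing the first vertex of \<open>p\<close> by \<open>x\<close> and \<open>y\<close> gives a
    longer path. One color more than \<open>p\<close> needs is enough.

  \<^item> \<open>K\<^sub>2 + 2K\<^sub>1\<close>-free: an edge off a longest path forces the two ends of the path to be adjacent. Then
    the path closes to a cycle, by maximality nothing else is joined to it, and what remains is a
    clique.

  \<^item> \<open>P\<^sub>4\<close>-free: in a coloring with the least sum of colors every vertex has neighbors in all smaller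
    colors, and \<open>P\<^sub>4\<close>-freeness turns this into a clique that meets all colors. A clique is spanned by
    a path.

  \<^item> \<open>4K\<^sub>1\<close>-free: let \<open>C\<close> be a component of what a longest path misses. If \<open>C\<close> is joined to the rest
    through at most one vertex, colorings of the two sides fit together, and induction applies. If
    there are two such vertices, then a vertex of \<open>C\<close>, the first vertex of the path and the two path
    successors of the attachment vertices are independent; this is the argument of Chvatal and Erdos
    for Hamiltonian paths (\<open>two_attachments_4K1\<close>).

  \<^item> \<open>P\<^sub>3 + K\<^sub>1\<close>-free: either there is no independent triple, and the previous case applies, or there are
    two cliques with no edges between them and with the same neighbors outside. The smaller of the
    two can be removed and colored like a part of the larger one.
\<close>

section \<open>Colorings and paths in a symmetric irreflexive relation\<close>

text \<open>
  Induced subgraphs are represented by their vertex sets inside one fixed adjacency relation. The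
  numbers \<open>\<chi>\<close> and \<open>\<r>\<close> appear only through their upper bounds \<open>colorable\<close> and \<open>paths_colorable\<close>, so that
  no minimum or maximum has to be handled in the combinatorial part.
\<close>

locale adjacency =
  fixes E :: "'a \<Rightarrow> 'a \<Rightarrow> bool"
  assumes sym: "E u v \<Longrightarrow> E v u"
    and irrefl: "\<not> E u u"
begin

definition colorable :: "'a set \<Rightarrow> nat \<Rightarrow> bool" where
  "colorable S k \<longleftrightarrow>
     (\<exists>c. c ` S \<subseteq> {..<k} \<and> (\<forall>u\<in>S. \<forall>v\<in>S. E u v \<longrightarrow> c u \<noteq> c v))"

definition path :: "'a set \<Rightarrow> 'a list \<Rightarrow> bool" where
  "path S p \<longleftrightarrow> set p \<subseteq> S \<and> distinct p \<and> successively E p"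

definition paths_colorable :: "'a set \<Rightarrow> nat \<Rightarrow> bool" where
  "paths_colorable S k \<longleftrightarrow> (\<forall>p. path S p \<longrightarrow> colorable (set p) k)"

definition longest_path :: "'a set \<Rightarrow> 'a list \<Rightarrow> bool" where
  "longest_path S p \<longleftrightarrow> path S p \<and> (\<forall>q. path S q \<longrightarrow> length q \<le> length p)"

definition clique :: "'a set \<Rightarrow> bool" where
  "clique W \<longleftrightarrow> (\<forall>u\<in>W. \<forall>v\<in>W. u \<noteq> v \<longrightarrow> E u v)"

text \<open>The six truth values list the adjacencies between \<open>w\<close>, \<open>x\<close>, \<open>y\<close>, \<open>z\<close> in lexicographic order, so that two
quadruples with the same values span isomorphic graphs.\<close>

definition induces :: "'a set \<Rightarrow> 'a \<Rightarrow> 'a \<Rightarrow> 'a \<Rightarrow> 'a \<Rightarrow>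
    bool \<Rightarrow> bool \<Rightarrow> bool \<Rightarrow> bool \<Rightarrow> bool \<Rightarrow> bool \<Rightarrow> bool" where
  "induces S w x y z wx wy wz xy xz yz \<longleftrightarrow> {w, x, y, z} \<subseteq> S \<and> distinct [w, x, y, z] \<and>
     E w x = wx \<and> E w y = wy \<and> E w z = wz \<and> E x y = xy \<and> E x z = xz \<and> E y z = yz"

definition "has_4K1 S \<longleftrightarrow> (\<exists>w x y z. induces S w x y z False False False False False False)"
definition "has_K2_2K1 S \<longleftrightarrow> (\<exists>w x y z. induces S w x y z True False False False False False)"
definition "has_2K2 S \<longleftrightarrow> (\<exists>w x y z. induces S w x y z True False False False False True)"
definition "has_P3_K1 S \<longleftrightarrow> (\<exists>w x y z. induces S w x y z True False False True False False)"
definition "has_P4 S \<longleftrightarrow> (\<exists>w x y z. induces S w x y z True False False True False True)"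
definition "has_claw S \<longleftrightarrow> (\<exists>w x y z. induces S w x y z True True True False False False)"

lemmas has_defs = has_4K1_def has_K2_2K1_def has_2K2_def has_P3_K1_def has_P4_def has_claw_def

lemma induces_subset: "induces S w x y z a b c d e f \<Longrightarrow> S \<subseteq> T \<Longrightarrow> induces T w x y z a b c d e f"
  unfolding induces_def by blast

lemma has_subset:
  assumes "S \<subseteq> T"
  shows "has_4K1 S \<Longrightarrow> has_4K1 T" and "has_P3_K1 S \<Longrightarrow> has_P3_K1 T" and "has_P4 S \<Longrightarrow> has_P4 T"
  unfolding has_defs using induces_subset[OF _ assms] by blast+

lemma sym_iff: "E u v \<longleftrightarrow> E v u"
  using sym by blast

lemma successively_rev_iff [simp]: "successively E (rev p) \<longleftrightarrow> successively E p"
proof -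
  have "(\<lambda>x y. E y x) = E"
    using sym by blast
  then show ?thesis
    by (rule trans[OF successively_rev arg_cong[where f = "\<lambda>R. successively R p"]])
qed

lemma colorable_subset: "colorable T k \<Longrightarrow> S \<subseteq> T \<Longrightarrow> colorable S k"
  unfolding colorable_def by (meson image_mono order_trans subsetD)

lemma paths_colorable_subset: "paths_colorable T k \<Longrightarrow> S \<subseteq> T \<Longrightarrow> paths_colorable S k"
  unfolding paths_colorable_def path_def by blast

lemma colorable_card:
  assumes "finite S"
  shows "colorable S (card S)"
proof -
  obtain c where "bij_betw c S {0..<card S}"
    using ex_bij_betw_finite_nat[OF assms] by blast
  then show ?thesis
    unfolding colorable_def bij_betw_def inj_on_def using irrefl
    by (intro exI[of _ c]) (metis atLeast0LessThan subset_refl)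
qed

lemma colorable_mono: "colorable S j \<Longrightarrow> j \<le> k \<Longrightarrow> colorable S k"
  unfolding colorable_def by (meson lessThan_subset_iff order_trans)

lemma clique_card_le_colors:
  assumes "clique W" "finite W" "colorable W k"
  shows "card W \<le> k"
proof -
  obtain c where c: "c ` W \<subseteq> {..<k}" "\<forall>u\<in>W. \<forall>v\<in>W. E u v \<longrightarrow> c u \<noteq> c v"
    using assms(3) unfolding colorable_def by blast
  have "inj_on c W"
    using c(2) assms(1) unfolding clique_def inj_on_def by blast
  then show ?thesis
    using card_inj_on_le[OF _ c(1)] by simp
qed

lemma clique_traceable:
  assumes "finite W" "clique W"
  obtains p where "path W p" "set p = W"
proof -
  obtain p where p: "set p = W" "distinct p"
    using finite_distinct_list[OF assms(1)] by blast
  have "clique (set q) \<Longrightarrow> distinct q \<Longrightarrow> successively E q" for q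
    by (induction q rule: induct_list012) (auto simp: clique_def)
  then show ?thesis
    using that p assms(2) unfolding path_def by blast
qed

text \<open>Any ordering of a clique is a path, so bounds for paths are also bounds for cliques.\<close>

lemma clique_le_paths_colorable:
  assumes "clique W" "finite W" "W \<subseteq> S" "paths_colorable S k"
  shows "card W \<le> k" "colorable W k"
proof -
  obtain p where "path W p" "set p = W"
    using clique_traceable assms(1,2) by blast
  then show "colorable W k"
    using assms(3,4) unfolding paths_colorable_def path_def by blast
  then show "card W \<le> k"
    using clique_card_le_colors assms by blast
qed

section \<open>Longest paths\<close>

lemma longest_path_exists:
  assumes "finite S"
  obtains p where "longest_path S p"
proof -
  have "length p < Suc (card S)" if "path S p" for p
    using that card_mono[OF assms, of "set p"] distinct_card[of p]
    unfolding path_def by simp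
  moreover have "path S []"
    by (simp add: path_def)
  ultimately show ?thesis
    using that ex_has_greatest_nat[of "path S" "[]" length "Suc (card S)"]
    unfolding longest_path_def by blast
qed

lemma longest_path_Nil:
  assumes "longest_path S []"
  shows "S = {}"
proof -
  have "path S [x]" if "x \<in> S" for x
    using that by (simp add: path_def)
  then show ?thesis
    using assms unfolding longest_path_def by fastforce
qed

lemma longest_path_hd:
  assumes "longest_path S p" "p \<noteq> []" "x \<in> S - set p"
  shows "\<not> E x (hd p)"
proof
  assume "E x (hd p)"
  then have "path S (x # p)"
    using assms unfolding longest_path_def path_def by (simp add: successively_Cons)
  then show False
    using assms unfolding longest_path_def by fastforce
qed

lemma longest_path_rev: "longest_path S p \<Longrightarrow> longest_path S (rev p)"
  using successively_rev_iff[of p] unfolding longest_path_def path_def by (simp del: successively_rev)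

lemma longest_path_last:
  assumes "longest_path S p" "p \<noteq> []" "x \<in> S - set p"
  shows "\<not> E x (last p)"
  using longest_path_hd[OF longest_path_rev[OF assms(1)], of x] assms(2,3) by (simp add: hd_rev)

section \<open>Combining colorings\<close>

lemma color_anticomplete:
  assumes "colorable C k" "colorable D k" "\<And>u v. u \<in> C \<Longrightarrow> v \<in> D \<Longrightarrow> \<not> E u v"
  shows "colorable (C \<union> D) k"
proof -
  obtain c1 where c1: "c1 ` C \<subseteq> {..<k}" "\<forall>u\<in>C. \<forall>v\<in>C. E u v \<longrightarrow> c1 u \<noteq> c1 v"
    using assms(1) unfolding colorable_def by blast
  obtain c2 where c2: "c2 ` D \<subseteq> {..<k}" "\<forall>u\<in>D. \<forall>v\<in>D. E u v \<longrightarrow> c2 u \<noteq> c2 v"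
    using assms(2) unfolding colorable_def by blast
  let ?c = "\<lambda>v. if v \<in> C then c1 v else c2 v"
  have "?c ` (C \<union> D) \<subseteq> {..<k}"
    using c1(1) c2(1) by auto
  moreover have "?c u \<noteq> ?c v" if "u \<in> C \<union> D" "v \<in> C \<union> D" "E u v" for u v
    using that c1(2) c2(2) assms(3)[of u v] assms(3)[of v u] sym[of u v] by auto
  ultimately show ?thesis
    unfolding colorable_def by blast
qed

text \<open>Exchanging two colors in the coloring of the side of \<open>C\<close> makes the two colorings agree at the cut vertex
\<open>a\<close>.\<close>

lemma color_cut_vertex:
  assumes C: "colorable (insert a C) k" and D: "colorable D k" and a: "a \<in> D" "a \<notin> C"
    and cut: "\<And>u v. u \<in> C \<Longrightarrow> v \<in> D \<Longrightarrow> E u v \<Longrightarrow> v = a"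
  shows "colorable (C \<union> D) k"
proof -
  obtain c1 where c1: "c1 ` insert a C \<subseteq> {..<k}"
      "\<forall>u\<in>insert a C. \<forall>v\<in>insert a C. E u v \<longrightarrow> c1 u \<noteq> c1 v"
    using C unfolding colorable_def by blast
  obtain c2 where c2: "c2 ` D \<subseteq> {..<k}" "\<forall>u\<in>D. \<forall>v\<in>D. E u v \<longrightarrow> c2 u \<noteq> c2 v"
    using D unfolding colorable_def by blast
  define t where "t = transpose (c1 a) (c2 a)"
  have t_inj: "t i = t j \<longleftrightarrow> i = j" for i j
    unfolding t_def by (metis transpose_involutory)
  have t_a: "t (c1 a) = c2 a"
    by (simp add: t_def)
  have t_bound: "t i < k" if "i < k" for i
    using that c1(1) c2(1) a(1) by (auto simp: t_def transpose_def)
  let ?c = "\<lambda>v. if v \<in> C then t (c1 v) else c2 v"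
  have "?c ` (C \<union> D) \<subseteq> {..<k}"
    using c1(1) c2(1) t_bound by auto
  moreover have "?c u \<noteq> ?c v" if "u \<in> C \<union> D" "v \<in> C \<union> D" "E u v" for u v
  proof -
    have mixed: "t (c1 u) \<noteq> c2 v" if "u \<in> C" "v \<in> D" "E u v" for u v
    proof -
      have "v = a"
        using cut that by blast
      then have "c1 u \<noteq> c1 a"
        using c1(2) that by blast
      then show ?thesis
        using \<open>v = a\<close> t_a t_inj by metis
    qed
    show ?thesis
      using that c1(2) c2(2) mixed[of u v] mixed[of v u] sym t_inj by auto
  qed
  ultimately show ?thesis
    unfolding colorable_def by blast
qed

section \<open>Graphs without four independent vertices\<close>

definition connected_in :: "'a set \<Rightarrow> 'a \<Rightarrow> 'a \<Rightarrow> bool" where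
  "connected_in U = (\<lambda>u v. E u v \<and> u \<in> U \<and> v \<in> U)\<^sup>*\<^sup>*"

lemma connected_in_refl [simp]: "connected_in U u u"
  by (simp add: connected_in_def)

lemma connected_in_step: "connected_in U u v \<Longrightarrow> E v w \<Longrightarrow> v \<in> U \<Longrightarrow> w \<in> U \<Longrightarrow> connected_in U u w"
  unfolding connected_in_def by (rule rtranclp.rtrancl_into_rtrancl) auto

lemma connected_in_sym: "connected_in U u v \<Longrightarrow> connected_in U v u"
  unfolding connected_in_def by (rule sympD[OF symp_rtranclp]) (auto intro!: sympI sym)

lemma connected_in_trans: "connected_in U u v \<Longrightarrow> connected_in U v w \<Longrightarrow> connected_in U u w"
  unfolding connected_in_def by (rule rtranclp_trans)

lemma connected_in_mem: "connected_in U u v \<Longrightarrow> u \<in> U \<Longrightarrow> v \<in> U"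
  unfolding connected_in_def by (induction rule: rtranclp_induct) auto

lemma connected_in_path:
  assumes "connected_in U u v" "u \<in> U"
  obtains q where "path U q" "q \<noteq> []" "hd q = u" "last q = v"
proof -
  have "\<exists>q. path U q \<and> q \<noteq> [] \<and> hd q = u \<and> last q = v"
    using assms(1) unfolding connected_in_def
  proof (induction rule: rtranclp_induct)
    case base
    show ?case
      using assms(2) by (intro exI[of _ "[u]"]) (simp add: path_def)
  next
    case (step v w)
    then obtain q where q: "path U q" "q \<noteq> []" "hd q = u" "last q = v"
      by blast
    show ?case
    proof (cases "w \<in> set q")
      case True
      then obtain q1 q2 where "q = q1 @ w # q2"
        by (meson split_list)
      then have "q = (q1 @ [w]) @ q2"
        by simp
      then show ?thesis
        using q unfolding path_def
        by (intro exI[of _ "q1 @ [w]"]) (auto simp: successively_append_iff hd_append)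
    next
      case False
      then show ?thesis
        using q step(2) unfolding path_def
        by (intro exI[of _ "q @ [w]"]) (auto simp: successively_append_iff)
    qed
  qed
  then show ?thesis
    using that by blast
qed

text \<open>Otherwise a detour from \<open>a\<close> to \<open>b\<close> through the vertices off the path would lengthen it.\<close>

lemma no_consecutive_attachments:
  assumes p: "longest_path S p" "p = p1 @ a # b # p2"
    and c: "connected_in (S - set p) c c'" "c \<in> S - set p" "E a c"
  shows "\<not> E c' b"
proof
  assume "E c' b"
  obtain q where q: "path (S - set p) q" "q \<noteq> []" "hd q = c" "last q = c'"
    using connected_in_path c(1,2) by blast
  have "path S (p1 @ a # q @ b # p2)"
    using p q \<open>E c' b\<close> \<open>E a c\<close> unfolding longest_path_def path_def
    by (auto simp: successively_append_iff successively_Cons)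
  then show False
    using p q(2) unfolding longest_path_def by fastforce
qed

text \<open>Otherwise the path could start at \<open>c\<close>, run from \<open>a\<close> back to its old first vertex, and go on from \<open>b\<close>.\<close>

lemma successor_not_adjacent_hd:
  assumes p: "longest_path S p" "p = p1 @ a # b # p2" and c: "c \<in> S - set p" "E c a"
  shows "\<not> E (hd p) b"
proof
  assume "E (hd p) b"
  define r where "r = rev (p1 @ [a])"
  have r: "r \<noteq> []" "hd r = a" "last r = hd p"
    using p(2) by (auto simp: r_def last_rev hd_append)
  have "successively E r" "successively E (b # p2)"
    using p unfolding r_def longest_path_def path_def successively_rev_iff
    by (auto simp: successively_append_iff successively_Cons)
  then have "successively E ([c] @ r @ b # p2)"
    using r c(2) \<open>E (hd p) b\<close> unfolding successively_append_iff by simp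
  moreover have "set r = set (p1 @ [a])" "distinct r" "length r = length (p1 @ [a])"
    using p unfolding r_def longest_path_def path_def by auto
  ultimately have "path S ([c] @ r @ b # p2)"
    using p c(1) unfolding longest_path_def path_def by auto
  then show False
    using p \<open>length r = _\<close> unfolding longest_path_def by fastforce
qed

text \<open>Otherwise the path could leave at \<open>a\<close>, reach \<open>d\<close> through vertices off the path, run back from \<open>d\<close> to
\<open>b\<close> and go on from \<open>e\<close>.\<close>

lemma successors_not_adjacent:
  assumes p: "longest_path S p" "p = p1 @ a # b # p2 @ d # e # p3"
    and c: "connected_in (S - set p) c c'" "c \<in> S - set p" "E a c" "E c' d"
  shows "\<not> E b e"
proof
  assume "E b e"
  obtain q where q: "path (S - set p) q" "q \<noteq> []" "hd q = c" "last q = c'"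
    using connected_in_path c(1,2) by blast
  have parts: "successively E (p1 @ [a])" "successively E (rev (b # p2 @ [d]))" "successively E (e # p3)"
    using p unfolding longest_path_def path_def successively_rev_iff
    by (auto simp: successively_append_iff successively_Cons hd_append)
  have "successively E ((p1 @ [a]) @ q @ rev (b # p2 @ [d]) @ e # p3)"
    using parts q c(3,4) \<open>E b e\<close>
    unfolding path_def successively_append_iff by simp
  then have "path S ((p1 @ [a]) @ q @ rev (b # p2 @ [d]) @ e # p3)"
    using p q unfolding longest_path_def path_def by auto
  then show False
    using p q(2) unfolding longest_path_def by fastforce
qed

lemma split_list_two:
  assumes "a \<in> set p" "d \<in> set p" "d \<noteq> a"
  shows "\<exists>xs ys zs. p = xs @ a # ys @ d # zs \<or> p = xs @ d # ys @ a # zs"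
proof -
  obtain u w where p: "p = u @ a # w"
    using assms(1) split_list by metis
  then consider "d \<in> set u" | "d \<in> set w"
    using assms(2,3) by auto
  then show ?thesis
  proof cases
    case 1
    then obtain u1 u2 where "u = u1 @ d # u2"
      using split_list by metis
    then have "p = u1 @ d # u2 @ a # w"
      using p by simp
    then show ?thesis
      by blast
  next
    case 2
    then show ?thesis
      using p split_list by metis
  qed
qed

text \<open>The case of connectivity two of the theorem of Chvatal and Erdos on Hamiltonian paths. The independent
vertices are \<open>c\<close>, the first vertex of the path, and the successors of \<open>a\<close> and \<open>d\<close>. The detour
between \<open>a\<close> and \<open>d\<close> uses a connection of \<open>c\<close> and \<open>c'\<close> off the path.\<close>

lemma two_attachments_4K1:
  assumes p: "longest_path S p" "p = xs @ a # ys @ d # zs"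
    and c: "connected_in (S - set p) c c'" "c \<in> S - set p" "c' \<in> S - set p" "E c a" "E c' d"
  shows "has_4K1 S"
proof -
  have "p \<noteq> []" and "xs \<noteq> []" and "zs \<noteq> []"
    using p(2) c longest_path_hd[OF p(1)] longest_path_last[OF p(1)] by fastforce+
  moreover have "ys \<noteq> []"
    using no_consecutive_attachments[OF p(1) _ c(1,2)] p(2) c(4,5) sym by fastforce
  ultimately obtain h xs' b ys' e zs' where
    split: "xs = h # xs'" "ys = b # ys'" "zs = e # zs'"
    by (meson neq_Nil_conv)
  have p1: "p = xs @ a # b # (ys' @ d # e # zs')" and p2: "p = (xs @ a # b # ys') @ d # e # zs'"
    using p(2) split by simp_all
  have h: "h = hd p"
    using p(2) split by simp
  have "\<not> E c h"
    using longest_path_hd[OF p(1) \<open>p \<noteq> []\<close> c(2)] h by simp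
  moreover have "\<not> E c b"
    using no_consecutive_attachments[OF p(1) p1 connected_in_refl c(2) sym[OF c(4)]] .
  moreover have "\<not> E c e"
    using no_consecutive_attachments[OF p(1) p2 connected_in_sym[OF c(1)] c(3) sym[OF c(5)]] .
  moreover have "\<not> E h b"
    using successor_not_adjacent_hd[OF p(1) p1 c(2,4)] h by simp
  moreover have "\<not> E h e"
    using successor_not_adjacent_hd[OF p(1) p2 c(3,5)] h by simp
  moreover have "\<not> E b e"
    using successors_not_adjacent[OF p(1) p1 c(1,2) sym[OF c(4)] c(5)] .
  moreover have "{c, h, b, e} \<subseteq> S" "distinct [c, h, b, e]"
    using p c(2) split unfolding longest_path_def path_def by auto
  ultimately have "induces S c h b e False False False False False False"
    unfolding induces_def by simp
  then show ?thesis
    unfolding has_4K1_def by blast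
qed

text \<open>A component \<open>C\<close> of the set missed by a longest path has at most one neighbor \<open>a\<close> outside, by the previous
lemma. The induction applies to \<open>C\<close> together with \<open>a\<close> and to the complement of \<open>C\<close>. The first set is
smaller than \<open>S\<close> because the first vertex of a longest path is never the attachment vertex \<open>a\<close>.\<close>

theorem colorable_if_4K1_free:
  assumes "finite S" "\<not> has_4K1 S" "paths_colorable S k"
  shows "colorable S k"
  using assms
proof (induction S rule: finite_psubset_induct)
  case (psubset S)
  have smaller: "colorable T k" if "T \<subset> S" for T
    using psubset.IH[OF that] psubset.prems that has_subset(1) paths_colorable_subset
    by (meson psubset_imp_subset)
  obtain p where p: "longest_path S p"
    using longest_path_exists psubset.hyps by blast
  then have pS: "set p \<subseteq> S"
    by (simp add: longest_path_def path_def)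
  show ?case
  proof (cases "set p = S")
    case True
    then show ?thesis
      using p psubset.prems(2) unfolding longest_path_def paths_colorable_def by blast
  next
    case False
    then obtain x where x: "x \<in> S - set p"
      using pS by blast
    then have "p \<noteq> []"
      using p longest_path_Nil by blast
    define C where "C = {v. connected_in (S - set p) x v}"
    define D where "D = S - C"
    have CU: "C \<subseteq> S - set p"
      using connected_in_mem x by (auto simp: C_def)
    have xC: "x \<in> C"
      by (simp add: C_def connected_in_def)
    have connected: "connected_in (S - set p) u v" if "u \<in> C" "v \<in> C" for u v
      using connected_in_trans[OF connected_in_sym, of "S - set p" x u v] that by (simp add: C_def)
    have outside: "v \<in> set p" if "u \<in> C" "v \<in> D" "E u v" for u v
      using connected_in_step[of "S - set p" x u v] that CU by (auto simp: C_def D_def)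
    have S: "S = C \<union> D"
      using CU by (auto simp: D_def)
    have hd_D: "hd p \<in> D"
      using \<open>p \<noteq> []\<close> pS CU by (auto simp: D_def)
    have "D \<subset> S"
      using xC CU by (auto simp: D_def)
    then have colD: "colorable D k"
      using smaller by blast
    show ?thesis
    proof (cases "\<exists>u\<in>C. \<exists>v\<in>D. E u v")
      case False
      moreover have "C \<subset> S"
        using hd_D CU unfolding D_def by blast
      ultimately have "colorable (C \<union> D) k"
        using color_anticomplete[OF smaller colD] by blast
      then show ?thesis
        by (simp only: S[symmetric])
    next
      case True
      then obtain c a where ca: "c \<in> C" "a \<in> D" "E c a"
        by blast
      have unique: "d = a" if "c' \<in> C" "d \<in> D" "E c' d" for c' d
      proof (rule ccontr)
        assume "d \<noteq> a"
        have "a \<in> set p" "d \<in> set p"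
          using outside ca that by blast+
        then consider xs ys zs where "p = xs @ a # ys @ d # zs" | xs ys zs where "p = xs @ d # ys @ a # zs"
          using \<open>d \<noteq> a\<close> split_list_two by metis
        moreover have "c \<in> S - set p" "c' \<in> S - set p" "connected_in (S - set p) c c'"
            "connected_in (S - set p) c' c"
          using connected ca(1) that(1) CU by blast+
        ultimately have "has_4K1 S"
          using two_attachments_4K1[OF p] ca(3) that(3) by cases metis+
        then show False
          using psubset.prems(1) by blast
      qed
      \<comment> \<open>The first vertex of the path witnesses that \<open>insert a C\<close> is a proper subset.\<close>
      have "a \<noteq> hd p"
        using longest_path_hd[OF p \<open>p \<noteq> []\<close>] ca CU by blast
      then have "insert a C \<subset> S"
        using hd_D ca CU unfolding D_def by blast
      moreover have "a \<notin> C"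
        using ca(2) by (simp add: D_def)
      ultimately have "colorable (C \<union> D) k"
        by (intro color_cut_vertex[OF smaller colD ca(2)] unique)
      then show ?thesis
        by (simp only: S[symmetric])
    qed
  qed
qed

section \<open>Graphs in which one additional color suffices\<close>

lemma color_path_plus_one:
  assumes "path S p" "paths_colorable S k" "\<And>u v. u \<in> S - set p \<Longrightarrow> v \<in> S - set p \<Longrightarrow> \<not> E u v"
  shows "colorable S (Suc k)"
proof -
  obtain c where c: "c ` set p \<subseteq> {..<k}" "\<forall>u\<in>set p. \<forall>v\<in>set p. E u v \<longrightarrow> c u \<noteq> c v"
    using assms(1,2) unfolding paths_colorable_def colorable_def by blast
  have "(\<lambda>v. if v \<in> set p then c v else k) ` S \<subseteq> {..<Suc k}"
    using c(1) by (auto simp: less_Suc_eq)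
  moreover have "(if u \<in> set p then c u else k) \<noteq> (if v \<in> set p then c v else k)"
    if "u \<in> S" "v \<in> S" "E u v" for u v
    using c that assms(3)[of u v] by (auto split: if_splits)
  ultimately show ?thesis
    unfolding colorable_def by blast
qed

lemma longest_path_has_edge:
  assumes "longest_path S p" "E x y" "x \<in> S" "y \<in> S"
  obtains a b p' where "p = a # b # p'"
proof -
  have "path S [x, y]"
    using assms irrefl unfolding path_def by auto
  then have "2 \<le> length p"
    using assms(1) unfolding longest_path_def by fastforce
  then show ?thesis
    using that by (metis One_nat_def Suc_1 Suc_le_length_iff)
qed

text \<open>If \<open>xy\<close> is an edge off a longest path \<open>a, b, \<dots>\<close>, then neither end is joined to \<open>a\<close>, and an end joined to
\<open>b\<close> would allow \<open>a\<close> to be replaced by \<open>y, x\<close>. So \<open>xy\<close> and \<open>ab\<close> span \<open>2K\<^sub>2\<close>.\<close>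

theorem colorable_Suc_if_2K2_free:
  assumes "finite S" "\<not> has_2K2 S" "paths_colorable S k"
  shows "colorable S (Suc k)"
proof -
  obtain p where p: "longest_path S p"
    using longest_path_exists assms(1) by blast
  have "\<not> E x y" if xy: "x \<in> S - set p" "y \<in> S - set p" for x y
  proof
    assume "E x y"
    obtain a b p' where ab: "p = a # b # p'"
      using longest_path_has_edge[OF p \<open>E x y\<close>] xy by blast
    have not_b: "\<not> E u b" if "E u v" "u \<in> {x, y}" "v \<in> {x, y}" for u v
    proof
      assume "E u b"
      have "path S (v # u # b # p')"
        using p xy that \<open>E u b\<close> sym irrefl unfolding ab longest_path_def path_def by auto
      then show False
        using p unfolding ab longest_path_def by fastforce
    qed
    have "\<not> E x a" "\<not> E y a"
      using longest_path_hd[OF p] xy by (auto simp: ab)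
    then have "induces S x y a b True False False False False True"
      using p xy \<open>E x y\<close> not_b[of x y] not_b[of y x] sym irrefl
      unfolding ab longest_path_def path_def induces_def by auto
    then show False
      using assms(2) unfolding has_2K2_def by blast
  qed
  then show ?thesis
    using color_path_plus_one p assms(3) unfolding longest_path_def by blast
qed

text \<open>When the ends of a longest path are adjacent, the path can be rotated to start at any of its vertices, so
that every vertex behaves like an end.\<close>

lemma longest_path_closed:
  assumes p: "longest_path S p" "E (last p) (hd p)" and "z \<in> S - set p" "v \<in> set p"
  shows "\<not> E z v"
proof
  assume "E z v"
  obtain p1 p2 where p12: "p = p1 @ v # p2"
    using assms(4) split_list by metis
  have "successively E p1" "successively E (v # p2)" "p1 \<noteq> [] \<Longrightarrow> hd p = hd p1" "last p = last (v # p2)"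
    using p unfolding p12 longest_path_def path_def by (auto simp: successively_append_iff)
  then have "successively E ((v # p2) @ p1)"
    using p(2) unfolding successively_append_iff by (cases "p1 = []") auto
  then have "path S (z # v # p2 @ p1)"
    using p assms(3) \<open>E z v\<close> unfolding p12 longest_path_def path_def by auto
  then show False
    using p unfolding p12 longest_path_def by fastforce
qed

text \<open>An edge off a longest path sees neither end of the path, so these ends are adjacent and the path is not
joined to anything else. Two nonadjacent vertices off the path would then span \<open>K\<^sub>2 + 2K\<^sub>1\<close> with an
edge of the path, so the vertices off the path form a clique, which is itself spanned by a path.\<close>

theorem colorable_Suc_if_K2_2K1_free:
  assumes "finite S" "\<not> has_K2_2K1 S" "paths_colorable S k"
  shows "colorable S (Suc k)"
proof -
  obtain p where p: "longest_path S p"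
    using longest_path_exists assms(1) by blast
  show ?thesis
  proof (cases "\<exists>x\<in>S - set p. \<exists>y\<in>S - set p. E x y")
    case False
    then show ?thesis
      using color_path_plus_one p assms(3) unfolding longest_path_def by blast
  next
    case True
    then obtain x y where xy: "x \<in> S - set p" "y \<in> S - set p" "E x y"
      by blast
    obtain a b p' where ab: "p = a # b # p'"
      using longest_path_has_edge[OF p] xy by blast
    have "hd p \<noteq> last p" "hd p \<in> S" "last p \<in> S" "last p \<in> set p"
      using p unfolding longest_path_def path_def by (auto simp: ab)
    moreover have "\<not> E x (hd p)" "\<not> E y (hd p)" "\<not> E x (last p)" "\<not> E y (last p)"
      using longest_path_hd[OF p] longest_path_last[OF p] xy by (auto simp: ab)
    moreover have "\<not> induces S x y (hd p) (last p) True False False False False False"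
      using assms(2) unfolding has_K2_2K1_def by blast
    ultimately have "E (last p) (hd p)"
      using xy sym irrefl unfolding induces_def by (auto simp: ab)
    then have apart: "\<not> E z v" if "z \<in> S - set p" "v \<in> set p" for z v
      using longest_path_closed[OF p] that by blast
    have "clique (S - set p)"
      unfolding clique_def
    proof (intro ballI impI)
      fix u v assume uv: "u \<in> S - set p" "v \<in> S - set p" "u \<noteq> v"
      have "{a, b} \<subseteq> set p" "set p \<subseteq> S" "E a b" "a \<noteq> b"
        using p unfolding longest_path_def path_def by (auto simp: ab)
      moreover have "\<not> induces S a b u v True False False False False False"
        using assms(2) unfolding has_K2_2K1_def by blast
      moreover have "\<not> E a u" "\<not> E a v" "\<not> E b u" "\<not> E b v"
        using uv apart sym \<open>{a, b} \<subseteq> set p\<close> by blast+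
      ultimately show "E u v"
        using uv unfolding induces_def by auto
    qed
    then have "colorable (S - set p) k"
      using clique_le_paths_colorable(2) assms(1,3) by blast
    moreover have "colorable (set p) k"
      using p assms(3) unfolding longest_path_def paths_colorable_def by blast
    moreover have "S - set p \<union> set p = S"
      using p unfolding longest_path_def path_def by blast
    ultimately have "colorable S k"
      using color_anticomplete[of "S - set p" k "set p"] apart by simp
    then show ?thesis
      by (rule colorable_mono) simp
  qed
qed

section \<open>Graphs without an induced path on four vertices\<close>

text \<open>A coloring with the least sum of colors is greedy: a vertex without a neighbor in some smaller color could
be moved to that color. From a vertex \<open>v\<close> a clique is extended downwards through all colors below that
of \<open>v\<close>, which bounds every color by the size of a clique and hence of a path.\<close>

theorem colorable_if_P4_free:
  assumes "finite S" "\<not> has_P4 S" "paths_colorable S k"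
  shows "colorable S k"
proof -
  define proper where "proper c \<longleftrightarrow> (\<forall>u\<in>S. \<forall>v\<in>S. E u v \<longrightarrow> c u \<noteq> c v)" for c :: "'a \<Rightarrow> nat"
  have "\<exists>c. proper c"
    using colorable_card[OF assms(1)] unfolding colorable_def proper_def by blast
  then obtain c where c: "proper c" and least: "\<And>c'. proper c' \<Longrightarrow> sum c S \<le> sum c' S"
    using ex_has_least_nat[of proper _ "\<lambda>c. sum c S"] by blast
  have greedy: "\<exists>u\<in>S. c u = i \<and> E u v" if v: "v \<in> S" "i < c v" for v i
  proof (rule ccontr)
    assume none: "\<not> ?thesis"
    have "proper (c(v := i))"
      using c none v(1) sym irrefl unfolding proper_def by auto
    moreover have "sum (c(v := i)) S < sum c S"
      using v assms(1) by (intro sum_strict_mono_ex1) auto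
    ultimately show False
      using least by (meson not_less)
  qed
  have clique_below: "\<exists>W\<subseteq>S. clique W \<and> c ` W = {i..c v}" if v: "v \<in> S" and "i \<le> c v" for v i
    using \<open>i \<le> c v\<close>
  proof (induction i rule: inc_induct)
    case base
    show ?case
      using v by (intro exI[of _ "{v}"]) (simp add: clique_def)
  next
    case (step i)
    then obtain W where W: "W \<subseteq> S" "clique W" "c ` W = {Suc i..c v}"
      by blast
    have "finite W"
      using W(1) assms(1) finite_subset by blast
    have below: "\<exists>u\<in>S. c u = i \<and> E u w" if "w \<in> W" for w
    proof -
      have "c w \<in> {Suc i..c v}"
        using W(3) that by blast
      then show ?thesis
        using greedy[of w i] W(1) that by auto
    qed
    define N where "N u = {w \<in> W. E u w}" for u
    have "v \<in> S \<and> i < c v"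
      using v step.hyps by simp
    then obtain u0 where "u0 \<in> S" "c u0 = i"
      using greedy by blast
    moreover have "card (N u) < Suc (card W)" for u
      using card_mono[OF \<open>finite W\<close>, of "N u"] unfolding N_def by auto
    ultimately obtain x where x: "x \<in> S" "c x = i"
      and most: "\<And>y. y \<in> S \<Longrightarrow> c y = i \<Longrightarrow> card (N y) \<le> card (N x)"
      using ex_has_greatest_nat[of "\<lambda>u. u \<in> S \<and> c u = i" u0 "\<lambda>u. card (N u)" "Suc (card W)"] by blast
    \<comment> \<open>The vertex \<open>x\<close> of color \<open>i\<close> sees as much of \<open>W\<close> as possible. If it missed \<open>w\<close>, a vertex \<open>y\<close> of the
      same color that sees \<open>w\<close> would have to miss some neighbor \<open>z\<close> of \<open>x\<close>, and \<open>x, z, w, y\<close> would be an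
      induced path.\<close>
    have "E x w" if "w \<in> W" for w
    proof (rule ccontr)
      assume "\<not> E x w"
      obtain y where y: "y \<in> S" "c y = i" "E y w"
        using below \<open>w \<in> W\<close> by blast
      have "\<not> N x \<subset> N y"
        using most[OF y(1,2)] psubset_card_mono[of "N y" "N x"] \<open>finite W\<close> by (auto simp: N_def)
      moreover have "w \<in> N y - N x"
        using \<open>w \<in> W\<close> y(3) \<open>\<not> E x w\<close> by (simp add: N_def)
      ultimately obtain z where z: "z \<in> W" "E x z" "\<not> E y z"
        unfolding N_def by blast
      have "\<not> E x y"
        using c x y unfolding proper_def by metis
      moreover have "z \<noteq> w"
        using z(3) y(3) by blast
      moreover from this have "E z w"
        using W(2) z(1) \<open>w \<in> W\<close> unfolding clique_def by blast
      ultimately have "induces S x z w y True False False True False True"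
        using x y z W(1) \<open>w \<in> W\<close> \<open>\<not> E x w\<close> sym irrefl unfolding induces_def by auto
      then show False
        using assms(2) unfolding has_P4_def by blast
    qed
    then have "clique (insert x W)"
      using W(2) sym unfolding clique_def by blast
    moreover have "c ` insert x W = {i..c v}"
      using W(3) x(2) step.hyps by auto
    ultimately show ?case
      using W(1) x(1) by (intro exI[of _ "insert x W"]) simp
  qed
  have "c v < k" if v: "v \<in> S" for v
  proof -
    obtain W where W: "W \<subseteq> S" "clique W" "c ` W = {0..c v}"
      using clique_below[OF v, of 0] by auto
    have "finite W"
      using W(1) assms(1) finite_subset by blast
    then have "Suc (c v) \<le> card W"
      using card_image_le[of W c] W(3) by simp
    then show ?thesis
      using clique_le_paths_colorable(1)[OF W(2) \<open>finite W\<close> W(1) assms(3)] by simp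
  qed
  then show ?thesis
    using c unfolding colorable_def proper_def by blast
qed

section \<open>Graphs without an induced path on three vertices plus a vertex\<close>

text \<open>An injection of \<open>A\<close> into \<open>B\<close> is a homomorphism to the graph without \<open>A\<close>: it keeps distinct vertices of
\<open>A\<close> adjacent because \<open>B\<close> is a clique, and \<open>dominated\<close> preserves the edges that leave \<open>A\<close>.\<close>

lemma color_dominated_clique:
  assumes "finite S" and A: "clique A" "A \<subseteq> S" and B: "clique B" "B \<subseteq> S"
    and "A \<inter> B = {}" and le: "card A \<le> card B"
    and dominated: "\<And>u v w. u \<in> A \<Longrightarrow> v \<in> S - A \<Longrightarrow> E u v \<Longrightarrow> w \<in> B \<Longrightarrow> E w v"
    and col: "colorable (S - A) k"
  shows "colorable S k"
proof -
  obtain c where c: "c ` (S - A) \<subseteq> {..<k}" "\<forall>u\<in>S - A. \<forall>v\<in>S - A. E u v \<longrightarrow> c u \<noteq> c v"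
    using col unfolding colorable_def by blast
  obtain f where f: "f ` A \<subseteq> B" "inj_on f A"
    using card_le_inj[OF _ _ le] A(2) B(2) \<open>finite S\<close> finite_subset by metis
  have f_mem: "f u \<in> S - A" if "u \<in> A" for u
    using that f(1) B(2) \<open>A \<inter> B = {}\<close> by blast
  define g where "g v = (if v \<in> A then f v else v)" for v
  have "E (g u) (g v)" if "u \<in> S" "v \<in> S" "E u v" for u v
  proof -
    have "u \<noteq> v"
      using that(3) irrefl by blast
    then have "E (f u) (f v)" if "u \<in> A" "v \<in> A"
      using that f B(1) unfolding clique_def inj_on_def by blast
    moreover have "E (f u) v" if "u \<in> A" "v \<in> S - A" "E u v" for u v
      using dominated[OF that] f(1) that(1) by blast
    from this[of u v] this[of v u] have "u \<in> A \<Longrightarrow> v \<notin> A \<Longrightarrow> E (f u) v" "u \<notin> A \<Longrightarrow> v \<in> A \<Longrightarrow> E u (f v)"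
      using that sym[of u v] sym[of "f v" u] by auto
    ultimately show ?thesis
      using that(3) by (simp add: g_def)
  qed
  moreover have "g v \<in> S - A" if "v \<in> S" for v
    using that f_mem by (simp add: g_def)
  ultimately have "(c \<circ> g) ` S \<subseteq> {..<k}" "\<forall>u\<in>S. \<forall>v\<in>S. E u v \<longrightarrow> (c \<circ> g) u \<noteq> (c \<circ> g) v"
    using c by fastforce+
  then show ?thesis
    unfolding colorable_def by blast
qed

text \<open>Let \<open>I\<close> be a largest independent set, with at least three elements. A vertex outside \<open>I\<close> that sees at
least two vertices of \<open>I\<close> sees all of \<open>I\<close>, so it sees exactly one vertex of \<open>I\<close> or all of them. The
vertices that see only \<open>s\<close> form with \<open>s\<close> a clique \<open>A s\<close>, different cliques \<open>A s\<close> are not joined, and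
any vertex outside that sees a member of some \<open>A s\<close> sees every member of every \<open>A t\<close>. In each of these
statements a failure leaves an induced \<open>P\<^sub>3\<close> through a vertex of \<open>I\<close> that misses another vertex.\<close>

theorem colorable_if_P3_K1_free:
  assumes "finite S" "\<not> has_P3_K1 S" "paths_colorable S k"
  shows "colorable S k"
  using assms
proof (induction S rule: finite_psubset_induct)
  case (psubset S)
  have P3: False
    if "{w, x, y, v} \<subseteq> S" "E w x" "E x y" "w \<noteq> y" "\<not> E w y" "\<not> E v w" "\<not> E v x" "\<not> E v y" for w x y v
  proof -
    have "induces S w x y v True False False True False False"
      using that sym[of w v] sym[of x v] sym[of y v] sym[of w x] sym[of x y] irrefl
      unfolding induces_def by auto
    then show False
      using psubset.prems(1) unfolding has_P3_K1_def by blast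
  qed
  define indep where "indep I \<longleftrightarrow> I \<subseteq> S \<and> (\<forall>u\<in>I. \<forall>v\<in>I. \<not> E u v)" for I
  show ?case
  proof (cases "\<exists>I. indep I \<and> card I = 3")
    case False
    have "\<not> has_4K1 S"
    proof
      assume "has_4K1 S"
      then obtain w x y z where "induces S w x y z False False False False False False"
        unfolding has_4K1_def by blast
      then have "indep {w, x, y}" "card {w, x, y} = 3"
        unfolding induces_def indep_def using sym irrefl by auto
      then show False
        using False by blast
    qed
    then show ?thesis
      using colorable_if_4K1_free psubset.hyps psubset.prems(2) by blast
  next
    case True
    then obtain I0 where I0: "indep I0" "card I0 = 3"
      by blast
    have "card I < Suc (card S)" if "indep I" for I
      using that card_mono[OF psubset.hyps] unfolding indep_def by (simp add: less_Suc_eq_le)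
    then obtain I where I: "indep I" and most: "\<And>J. indep J \<Longrightarrow> card J \<le> card I"
      using ex_has_greatest_nat[of indep I0 card] I0(1) by blast
    have IS: "I \<subseteq> S" and I_E: "\<And>u v. u \<in> I \<Longrightarrow> v \<in> I \<Longrightarrow> \<not> E u v"
      using I by (auto simp: indep_def)
    have "finite I"
      using IS psubset.hyps finite_subset by blast
    have "3 \<le> card I"
      using most[OF I0(1)] I0(2) by simp
    have third: "\<exists>u\<in>I. u \<noteq> s \<and> u \<noteq> t" for s t
    proof (rule ccontr)
      assume "\<not> ?thesis"
      then have "I \<subseteq> {s, t}"
        by blast
      then have "card I \<le> card {s, t}"
        by (intro card_mono) auto
      also have "\<dots> \<le> 2"
        by (simp add: card_insert_if)
      finally show False
        using \<open>3 \<le> card I\<close> by simp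
    qed
    have touches: "\<exists>s\<in>I. E s v" if "v \<in> S - I" for v
    proof (rule ccontr)
      assume "\<not> ?thesis"
      then have "indep (insert v I)"
        using that IS I_E sym irrefl unfolding indep_def by blast
      then show False
        using most[of "insert v I"] that \<open>finite I\<close> by simp
    qed
    define A where "A s = insert s {v \<in> S. \<forall>t\<in>I. E t v \<longleftrightarrow> t = s}" for s
    have A_S: "A s \<subseteq> S" if "s \<in> I" for s
      using that IS by (auto simp: A_def)
    have A_I: "E t v \<longleftrightarrow> t = s" if "v \<in> A s" "v \<noteq> s" "t \<in> I" for s t v
      using that by (auto simp: A_def)
    have A_notin: "v \<notin> I" if "s \<in> I" "v \<in> A s" "v \<noteq> s" for s v
      using that I_E A_I by blast
    \<comment> \<open>A vertex that sees two members \<open>r\<close>, \<open>t\<close> of \<open>I\<close> sees all members \<open>s\<close>, as \<open>r, v, t\<close> is an induced path.\<close>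
    have full: "E s v" if "v \<in> S" "v \<notin> I" "\<And>s. s \<in> I \<Longrightarrow> v \<notin> A s" "s \<in> I" for s v
    proof (rule ccontr)
      assume "\<not> E s v"
      obtain r where r: "r \<in> I" "E r v"
        using touches \<open>v \<in> S\<close> \<open>v \<notin> I\<close> by blast
      moreover have "v \<notin> A r"
        using that(3) r(1) by blast
      ultimately obtain t where t: "t \<in> I" "E t v" "t \<noteq> r"
        using \<open>v \<in> S\<close> unfolding A_def by blast
      show False
        using P3[of r v t s] r t that(1,4) IS I_E sym[OF t(2)] \<open>\<not> E s v\<close> by blast
    qed
    have A_clique: "clique (A s)" if s: "s \<in> I" for s
    proof -
      have "E u v" if uv: "u \<in> A s" "v \<in> A s" "u \<noteq> v" "u \<noteq> s" "v \<noteq> s" for u v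
      proof (rule ccontr)
        assume "\<not> E u v"
        obtain t where t: "t \<in> I" "t \<noteq> s"
          using third by blast
        have "E u s" "E s v" "\<not> E t u" "\<not> E t v" "u \<notin> I" "v \<notin> I"
          using A_I A_notin uv s t sym by blast+
        then show False
          using P3[of u s v t] uv(1-3) s t IS A_S[OF s] I_E \<open>\<not> E u v\<close> by blast
      qed
      then show ?thesis
        using A_I[of _ s s] s sym unfolding clique_def by metis
    qed
    have A_apart: "\<not> E u v" if st: "s \<in> I" "t \<in> I" "s \<noteq> t" and uv: "u \<in> A s" "v \<in> A t" for s t u v
    proof
      assume "E u v"
      then have "u \<noteq> s" "v \<noteq> t"
        using A_I[OF uv(2)] A_I[OF uv(1)] st I_E sym by metis+
      obtain r where r: "r \<in> I" "r \<noteq> s" "r \<noteq> t"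
        using third by blast
      have "E s u" "\<not> E r u" "\<not> E r v" "\<not> E s v" "u \<notin> I" "v \<notin> I"
        using A_I A_notin uv st r \<open>u \<noteq> s\<close> \<open>v \<noteq> t\<close> by metis+
      then show False
        using P3[of s u v r] \<open>E u v\<close> r(1) st(1) IS A_S[OF st(1)] A_S[OF st(2)] uv I_E by blast
    qed
    obtain s t where st: "s \<in> I" "t \<in> I" "s \<noteq> t" "card (A s) \<le> card (A t)"
    proof -
      obtain s where "s \<in> I"
        using third by blast
      moreover obtain t where "t \<in> I" "t \<noteq> s"
        using third by blast
      ultimately show ?thesis
        using that[of s t] that[of t s] by (metis nat_le_linear)
    qed
    have "E w v" if u: "u \<in> A s" and v: "v \<in> S - A s" and "E u v" and w: "w \<in> A t" for u v w
    proof -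
      have not_A: "v \<notin> A r" if "r \<in> I" for r
        using A_apart[OF st(1) that _ u] v \<open>E u v\<close> by blast
      then have "v \<notin> I"
        by (auto simp: A_def)
      have v_I: "E r v" if "r \<in> I" for r
        using full \<open>v \<notin> I\<close> not_A that v by blast
      obtain r where r: "r \<in> I" "r \<noteq> s" "r \<noteq> t"
        using third by blast
      show ?thesis
      proof (rule ccontr)
        assume "\<not> E w v"
        then have "w \<noteq> t"
          using v_I st(2) by blast
        then have "\<not> E w s" "\<not> E w r"
          using A_I[OF w] st r sym[of w s] sym[of w r] by auto
        then show False
          using P3[of s v r w] v_I[OF st(1)] sym[OF v_I[OF r(1)]] \<open>\<not> E w v\<close> r st(1) IS
            A_S[OF st(2)] w v I_E by blast
      qed
    qed
    moreover have "colorable (S - A s) k"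
    proof (rule psubset.IH)
      show "S - A s \<subset> S"
        using A_S[OF st(1)] by (auto simp: A_def)
      show "\<not> has_P3_K1 (S - A s)"
        using psubset.prems(1) has_subset(2)[OF Diff_subset] by blast
      show "paths_colorable (S - A s) k"
        using psubset.prems(2) paths_colorable_subset by blast
    qed
    moreover have "A s \<inter> A t = {}"
    proof -
      have False if v: "v \<in> A s" "v \<in> A t" for v
      proof -
        have "v \<noteq> s" "v \<noteq> t"
          using A_notin[OF st(1) v(1)] A_notin[OF st(2) v(2)] st by auto
        then show False
          using A_I[OF v(1), of t] A_I[OF v(2), of t] st by simp
      qed
      then show ?thesis
        by blast
    qed
    ultimately show ?thesis
      using A_clique A_S st psubset.hyps
      by (intro color_dominated_clique[of S "A s" "A t" k]) auto
  qed
qed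

end

section \<open>Chromatic numbers as bounds\<close>

lemma adjacency_adj: "simple_graph G \<Longrightarrow> adjacency (adj G)"
  by unfold_locales (auto simp: adj_def simple_graph_def insert_commute)

lemma simple_graph_induced: "simple_graph G \<Longrightarrow> S \<subseteq> verts G \<Longrightarrow> simple_graph (induced G S)"
  unfolding simple_graph_def induced_def using finite_subset by auto

lemma verts_induced [simp]: "verts (induced G S) = S"
  by (simp add: induced_def)

lemma adj_induced: "adj (induced G S) u v \<longleftrightarrow> adj G u v \<and> u \<in> S \<and> v \<in> S"
  by (auto simp: adj_def induced_def)

lemma induced_induced: "T \<subseteq> S \<Longrightarrow> induced (induced G S) T = induced G T"
  by (auto simp: induced_def)

lemma induced_verts: "simple_graph G \<Longrightarrow> induced G (verts G) = G"
  by (cases G) (auto simp: induced_def simple_graph_def)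

lemma chromatic_number_le_iff:
  assumes "simple_graph G" "S \<subseteq> verts G"
  shows "\<chi> (induced G S) \<le> k \<longleftrightarrow> adjacency.colorable (adj G) S k"
proof -
  interpret adjacency "adj G"
    by (rule adjacency_adj[OF assms(1)])
  have proper: "(\<exists>c. proper_coloring (induced G S) c k) \<longleftrightarrow> colorable S k" for k
    unfolding proper_coloring_def colorable_def by (auto simp: adj_induced)
  have "finite S"
    using assms finite_subset unfolding simple_graph_def by blast
  then have "colorable S (\<chi> (induced G S))"
    using colorable_card unfolding chromatic_number_def proper by (rule_tac LeastI)
  then show ?thesis
    unfolding chromatic_number_def proper using colorable_mono Least_le[of "colorable S" k] by blast
qed

lemma path_chromatic_le_iff:
  assumes "simple_graph G" "S \<subseteq> verts G"
  shows "\<r> (induced G S) \<le> k \<longleftrightarrow> adjacency.paths_colorable (adj G) S k"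
proof -
  interpret adjacency "adj G"
    by (rule adjacency_adj[OF assms(1)])
  have "successively (adj (induced G S)) p \<longleftrightarrow> successively (adj G) p" if "set p \<subseteq> S" for p
    using that by (intro successively_cong) (auto simp: adj_induced)
  then have path: "path_in (induced G S) p \<longleftrightarrow> path S p" for p
    unfolding path_in_def path_def by auto
  have "finite S"
    using assms finite_subset unfolding simple_graph_def by blast
  then have "finite {p. path S p}"
    by (rule finite_subset[rotated, OF finite_subset_distinct]) (auto simp: path_def)
  moreover have "path S []"
    by (simp add: path_def)
  ultimately have "Max ((\<lambda>p. \<chi> (induced (induced G S) (set p))) ` {p. path S p}) \<le> k \<longleftrightarrow>
      (\<forall>n\<in>(\<lambda>p. \<chi> (induced (induced G S) (set p))) ` {p. path S p}. n \<le> k)"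
    by (intro Max_le_iff) auto
  then have "\<r> (induced G S) \<le> k \<longleftrightarrow> (\<forall>p. path S p \<longrightarrow> \<chi> (induced (induced G S) (set p)) \<le> k)"
    unfolding path_chromatic_def path by (simp add: setcompr_eq_image)
  moreover have "\<chi> (induced (induced G S) (set p)) \<le> k \<longleftrightarrow> colorable (set p) k" if "path S p" for p
  proof -
    have "set p \<subseteq> S"
      using that by (simp add: path_def)
    then show ?thesis
      using chromatic_number_le_iff[OF assms(1), of "set p"] assms(2)
      by (simp add: induced_induced)
  qed
  ultimately show ?thesis
    unfolding paths_colorable_def by simp
qed

text \<open>Only \<open>\<chi> \<le> \<r>\<close> has to be shown, as a coloring of a graph restricts to the vertices of each path.\<close>

lemma path_perfectI:
  assumes G: "simple_graph G"
    and "\<And>S k. S \<subseteq> verts G \<Longrightarrow> adjacency.paths_colorable (adj G) S k \<Longrightarrow> adjacency.colorable (adj G) S k"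
  shows "path_perfect G"
  unfolding path_perfect_def
proof (intro allI impI)
  fix S assume S: "S \<subseteq> verts G"
  interpret adjacency "adj G"
    by (rule adjacency_adj[OF G])
  have "\<chi> (induced G S) \<le> \<r> (induced G S)"
    unfolding chromatic_number_le_iff[OF G S]
    using assms(2)[OF S] path_chromatic_le_iff[OF G S] by blast
  moreover have "paths_colorable S (\<chi> (induced G S))"
    using chromatic_number_le_iff[OF G S] colorable_subset
    unfolding paths_colorable_def path_def by blast
  then have "\<r> (induced G S) \<le> \<chi> (induced G S)"
    unfolding path_chromatic_le_iff[OF G S] .
  ultimately show "\<chi> (induced G S) = \<r> (induced G S)"
    by simp
qed

section \<open>Recognizing induced subgraphs\<close>

text \<open>Isomorphisms between small graphs are given by two vertex lists of equal length. By symmetry it is enough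
to compare the positions \<open>i < j\<close>.\<close>

lemma iso_if_lists_match:
  assumes H: "simple_graph H" "distinct hs" "set hs = verts H"
    and K: "simple_graph K" "distinct ks" "set ks = verts K"
    and len: "length hs = length ks"
    and match: "\<And>i j. i < j \<Longrightarrow> j < length hs \<Longrightarrow> adj H (hs ! i) (hs ! j) = adj K (ks ! i) (ks ! j)"
  shows "H \<simeq> K"
proof -
  interpret H: adjacency "adj H"
    by (rule adjacency_adj[OF H(1)])
  interpret K: adjacency "adj K"
    by (rule adjacency_adj[OF K(1)])
  define f where "f v = ks ! inv_into {..<length hs} ((!) hs) v" for v
  have bij: "bij_betw ((!) hs) {..<length hs} (verts H)"
    using bij_betw_nth[OF H(2) refl] H(3) by simp
  then have f_nth: "f (hs ! i) = ks ! i" if "i < length hs" for i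
    using that by (simp add: f_def bij_betw_def inv_into_f_f)
  have "bij_betw ((!) ks) {..<length hs} (verts K)"
    using bij_betw_nth[OF K(2)] K(3) len by simp
  then have "bij_betw f (verts H) (verts K)"
    unfolding f_def using bij_betw_trans[OF bij_betw_inv_into[OF bij]] by (simp add: comp_def)
  moreover have "adj H u v \<longleftrightarrow> adj K (f u) (f v)" if uv: "u \<in> verts H" "v \<in> verts H" for u v
  proof -
    obtain i j where ij: "i < length hs" "j < length hs" "u = hs ! i" "v = hs ! j"
      using uv unfolding H(3)[symmetric] by (metis in_set_conv_nth)
    then have "adj H (hs ! i) (hs ! j) \<longleftrightarrow> adj K (ks ! i) (ks ! j)"
      using match[of i j] match[of j i] H.irrefl K.irrefl
        H.sym_iff[of "hs ! i" "hs ! j"] K.sym_iff[of "ks ! i" "ks ! j"]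
      by (cases i j rule: linorder_cases) auto
    then show ?thesis
      using ij f_nth by simp
  qed
  ultimately show ?thesis
    unfolding iso_def by blast
qed

lemma not_induced_free_if_lists_match:
  assumes H: "simple_graph H" "distinct hs" "set hs = verts H"
    and G: "simple_graph G" "distinct gs" "set gs \<subseteq> verts G"
    and len: "length gs = length hs"
    and match: "\<And>i j. i < j \<Longrightarrow> j < length gs \<Longrightarrow> adj G (gs ! i) (gs ! j) = adj H (hs ! i) (hs ! j)"
  shows "\<not> induced_free H G"
proof -
  have "induced G (set gs) \<simeq> H"
  proof (rule iso_if_lists_match[OF simple_graph_induced[OF G(1,3)] G(2) _ H len])
    fix i j assume "i < j" "j < length gs"
    then show "adj (induced G (set gs)) (gs ! i) (gs ! j) = adj H (hs ! i) (hs ! j)"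
      using match by (simp add: adj_induced)
  qed simp
  then show ?thesis
    using G(3) unfolding induced_free_def by blast
qed

lemma nat_pairs_below_4:
  "(\<forall>i j. i < j \<longrightarrow> j < (4::nat) \<longrightarrow> P i j) \<longleftrightarrow> P 0 1 \<and> P 0 2 \<and> P 0 3 \<and> P 1 2 \<and> P 1 3 \<and> P 2 3"
  by (auto simp: numeral_eq_Suc less_Suc_eq)

text \<open>Both sides are tables of the six adjacencies; the right one is indexed by the position \<open>i\<close> and the distance
of \<open>j\<close> from its successor, and is the same for every quadruple with the same pattern.\<close>

lemma (in adjacency) nth_induces:
  assumes "induces S w x y z a b c d e f" "i < j" "j < 4"
  shows "E ([w, x, y, z] ! i) ([w, x, y, z] ! j) = [[a, b, c], [d, e], [f]] ! i ! (j - Suc i)"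
proof -
  have "\<forall>i j. i < j \<longrightarrow> j < 4 \<longrightarrow>
      E ([w, x, y, z] ! i) ([w, x, y, z] ! j) = [[a, b, c], [d, e], [f]] ! i ! (j - Suc i)"
    using assms(1) unfolding nat_pairs_below_4 induces_def by (simp add: numeral_eq_Suc)
  then show ?thesis
    using assms(2,3) by blast
qed

lemma iso_if_same_pattern:
  assumes H: "simple_graph H" "verts H = {w, x, y, z}" "adjacency.induces (adj H) (verts H) w x y z a b c d e f"
    and K: "simple_graph K" "verts K = {w', x', y', z'}" "adjacency.induces (adj K) (verts K) w' x' y' z' a b c d e f"
  shows "H \<simeq> K"
proof -
  interpret H: adjacency "adj H"
    by (rule adjacency_adj[OF H(1)])
  interpret K: adjacency "adj K"
    by (rule adjacency_adj[OF K(1)])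
  show ?thesis
    using H K H.nth_induces[OF H(3)] K.nth_induces[OF K(3)]
    by (intro iso_if_lists_match[of H "[w, x, y, z]" K "[w', x', y', z']"])
      (auto simp: H.induces_def K.induces_def)
qed

lemma not_induced_free_if_same_pattern:
  assumes H: "simple_graph H" "verts H = {w, x, y, z}" "adjacency.induces (adj H) (verts H) w x y z a b c d e f"
    and G: "simple_graph G" "adjacency.induces (adj G) (verts G) w' x' y' z' a b c d e f"
  shows "\<not> induced_free H G"
proof -
  interpret H: adjacency "adj H"
    by (rule adjacency_adj[OF H(1)])
  interpret G: adjacency "adj G"
    by (rule adjacency_adj[OF G(1)])
  show ?thesis
    using H G H.nth_induces[OF H(3)] G.nth_induces[OF G(2)]
    by (intro not_induced_free_if_lists_match[of H "[w, x, y, z]" G "[w', x', y', z']"])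
      (auto simp: H.induces_def G.induces_def)
qed

text \<open>Without two edges at a common vertex the graph is a matching, which leaves \<open>4K\<^sub>1\<close>, \<open>K\<^sub>2 + 2K\<^sub>1\<close> and
\<open>2K\<^sub>2\<close>. Otherwise there is an induced path \<open>a, b, c\<close>, and the neighbors of the fourth vertex \<open>d\<close> decide:
\<open>b\<close> gives a claw, one of \<open>a\<close> and \<open>c\<close> gives \<open>P\<^sub>4\<close>, and none gives \<open>P\<^sub>3 + K\<^sub>1\<close>.\<close>

lemma (in adjacency) four_vertex_forest_cases:
  assumes S: "card S = 4"
    and tri: "\<And>a b c. {a, b, c} \<subseteq> S \<Longrightarrow> E a b \<Longrightarrow> E b c \<Longrightarrow> \<not> E a c"
    and quad: "\<And>a b c d. {a, b, c, d} \<subseteq> S \<Longrightarrow> distinct [a, b, c, d] \<Longrightarrow> E a b \<Longrightarrow> E b c \<Longrightarrow> E c d \<Longrightarrow> \<not> E a d"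
  shows "has_4K1 S \<or> has_K2_2K1 S \<or> has_2K2 S \<or> has_P3_K1 S \<or> has_P4 S \<or> has_claw S"
proof -
  have "finite S"
    using S card.infinite by fastforce
  show ?thesis
  proof (cases "\<exists>a\<in>S. \<exists>b\<in>S. \<exists>c\<in>S. a \<noteq> c \<and> E a b \<and> E b c")
    case True
    then obtain a b c where abc: "a \<in> S" "b \<in> S" "c \<in> S" "a \<noteq> c" "E a b" "E b c"
      by blast
    then have "a \<noteq> b" "b \<noteq> c" "\<not> E a c"
      using irrefl tri[of a b c] by auto
    then have "card (S - {a, b, c}) = 1"
      using abc S \<open>finite S\<close> by (simp add: card_Diff_subset)
    then obtain d where d: "d \<in> S" "d \<notin> {a, b, c}"
      by (metis DiffE card_1_singletonE insertI1)
    note adj = abc(5,6) sym[OF abc(5)] sym[OF abc(6)] \<open>\<not> E a c\<close> sym_iff[of a d] sym_iff[of b d] sym_iff[of c d]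
    consider "E b d" | "\<not> E b d" "E a d" | "\<not> E b d" "E c d" "\<not> E a d" | "\<not> E b d" "\<not> E a d" "\<not> E c d"
      by blast
    then show ?thesis
    proof cases
      case 1
      then have "induces S b a c d True True True False False False"
        using abc d \<open>a \<noteq> b\<close> \<open>b \<noteq> c\<close> adj tri[of a b d] tri[of c b d] unfolding induces_def by auto
      then show ?thesis
        unfolding has_claw_def by blast
    next
      case 2
      then have "induces S d a b c True False False True False True"
        using abc d \<open>a \<noteq> b\<close> \<open>b \<noteq> c\<close> adj quad[of d a b c] unfolding induces_def by auto
      then show ?thesis
        unfolding has_P4_def by blast
    next
      case 3
      then have "induces S a b c d True False False True False True"
        using abc d \<open>a \<noteq> b\<close> \<open>b \<noteq> c\<close> adj unfolding induces_def by auto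
      then show ?thesis
        unfolding has_P4_def by blast
    next
      case 4
      then have "induces S a b c d True False False True False False"
        using abc d \<open>a \<noteq> b\<close> \<open>b \<noteq> c\<close> adj unfolding induces_def by auto
      then show ?thesis
        unfolding has_P3_K1_def by blast
    qed
  next
    case False
    then have matching: "\<not> E b c" if "{a, b, c} \<subseteq> S" "a \<noteq> c" "E a b" for a b c
      using that by auto
    show ?thesis
    proof (cases "\<exists>a\<in>S. \<exists>b\<in>S. E a b")
      case True
      then obtain a b where ab: "a \<in> S" "b \<in> S" "E a b"
        by blast
      then have "a \<noteq> b"
        using irrefl by blast
      then have "card (S - {a, b}) = 2"
        using ab S \<open>finite S\<close> by (simp add: card_Diff_subset)
      then obtain c d where "S - {a, b} = {c, d}" "c \<noteq> d"
        by (meson card_2_iff)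
      then have cd: "c \<in> S" "d \<in> S" "c \<notin> {a, b}" "d \<notin> {a, b}" "c \<noteq> d"
        by blast+
      have "\<not> E a c" "\<not> E a d" "\<not> E b c" "\<not> E b d"
        using ab cd sym[OF ab(3)] matching[of b a c] matching[of b a d] matching[of a b c] matching[of a b d]
        by auto
      then have "induces S a b c d True False False False False (E c d)"
        using ab cd \<open>a \<noteq> b\<close> unfolding induces_def by auto
      then show ?thesis
        unfolding has_2K2_def has_K2_2K1_def by (cases "E c d") auto
    next
      case False
      obtain xs where xs: "set xs = S" "distinct xs"
        using finite_distinct_list[OF \<open>finite S\<close>] by blast
      then have "length xs = 4"
        using S distinct_card by metis
      then obtain w x y z where "xs = [w, x, y, z]"
        by (auto simp: numeral_eq_Suc length_Suc_conv)
      with xs have "S = {w, x, y, z}" "distinct [w, x, y, z]"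
        by auto
      then have "induces S w x y z False False False False False False"
        using False unfolding induces_def by auto
      then show ?thesis
        unfolding has_4K1_def by blast
    qed
  qed
qed

section \<open>Forests on at most four vertices\<close>

text \<open>Three isolated vertices are found in \<open>4K\<^sub>1\<close>, and every other triangle-free graph on at most three
vertices is found in \<open>P\<^sub>4\<close>.\<close>

lemma small_forest_not_induced_free:
  assumes H: "simple_graph H" "card (verts H) \<le> 3"
    and tri: "\<And>a b c. {a, b, c} \<subseteq> verts H \<Longrightarrow> adj H a b \<Longrightarrow> adj H b c \<Longrightarrow> \<not> adj H a c"
    and G: "simple_graph G" "adjacency.has_4K1 (adj G) (verts G)" "adjacency.has_P4 (adj G) (verts G)"
  shows "\<not> induced_free H G"
proof -
  interpret H: adjacency "adj H"
    by (rule adjacency_adj[OF H(1)])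
  interpret G: adjacency "adj G"
    by (rule adjacency_adj[OF G(1)])
  obtain w x y z where "G.induces (verts G) w x y z True False False True False True"
    using G(3) unfolding G.has_P4_def by blast
  then have P4: "{w, x, y, z} \<subseteq> verts G" "distinct [w, x, y, z]"
    "adj G w x" "adj G x y" "\<not> adj G w y" "\<not> adj G w z" "\<not> adj G x z"
    by (auto simp: G.induces_def)
  obtain p q r s where "G.induces (verts G) p q r s False False False False False False"
    using G(2) unfolding G.has_4K1_def by blast
  then have K1: "{p, q, r} \<subseteq> verts G" "distinct [p, q, r]" "\<not> adj G p q" "\<not> adj G p r" "\<not> adj G q r"
    by (auto simp: G.induces_def)
  have "finite (verts H)"
    using H(1) by (simp add: simple_graph_def)
  have embed: "\<not> induced_free H G"
    if "distinct hs" "set hs = verts H" "distinct gs" "set gs \<subseteq> verts G" "length gs = length hs"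
      "\<forall>j<length gs. \<forall>i<j. adj G (gs ! i) (gs ! j) = adj H (hs ! i) (hs ! j)" for gs hs
    using not_induced_free_if_lists_match[OF H(1) _ _ G(1)] that by blast
  consider "card (verts H) = 0" | "card (verts H) = 1" | "card (verts H) = 2" | "card (verts H) = 3"
    using H(2) by linarith
  then show ?thesis
  proof cases
    case 1
    then show ?thesis
      using embed[of "[]" "[]"] \<open>finite (verts H)\<close> by simp
  next
    case 2
    then obtain a where "verts H = {a}"
      using card_1_singletonE by blast
    then show ?thesis
      using embed[of "[a]" "[w]"] P4 by simp
  next
    case 3
    then obtain a b where "verts H = {a, b}" "a \<noteq> b"
      by (meson card_2_iff)
    then show ?thesis
      using embed[of "[a, b]" "[w, x]"] embed[of "[a, b]" "[w, y]"] P4 by (auto simp: less_Suc_eq)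
  next
    case 4
    show ?thesis
    proof (cases "\<exists>a\<in>verts H. \<exists>b\<in>verts H. adj H a b")
      case True
      then obtain a b where ab: "a \<in> verts H" "b \<in> verts H" "adj H a b"
        by blast
      then have "a \<noteq> b"
        using H.irrefl by blast
      then have "card (verts H - {a, b}) = 1"
        using ab 4 \<open>finite (verts H)\<close> by (simp add: card_Diff_subset)
      then obtain c where "verts H - {a, b} = {c}"
        using card_1_singletonE by blast
      then have V: "verts H = {a, b, c}" "c \<noteq> a" "c \<noteq> b"
        using ab by auto
      consider "adj H b c" "\<not> adj H a c" | "adj H a c" "\<not> adj H b c" | "\<not> adj H a c" "\<not> adj H b c"
        using tri[of a b c] V ab(3) by blast
      then show ?thesis
      proof cases
        case 1
        then show ?thesis
          using embed[of "[a, b, c]" "[w, x, y]"] V P4 ab(3) \<open>a \<noteq> b\<close> by (auto simp: less_Suc_eq)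
      next
        case 2
        then show ?thesis
          using embed[of "[b, a, c]" "[w, x, y]"] V P4 H.sym[OF ab(3)] \<open>a \<noteq> b\<close>
          by (auto simp: less_Suc_eq)
      next
        case 3
        then show ?thesis
          using embed[of "[a, b, c]" "[w, x, z]"] V P4 ab(3) \<open>a \<noteq> b\<close> by (auto simp: less_Suc_eq)
      qed
    next
      case False
      obtain a b c where "verts H = {a, b, c}" "distinct [a, b, c]"
        using 4 by (auto simp: card_3_iff)
      then show ?thesis
        using embed[of "[a, b, c]" "[p, q, r]"] K1 False by (auto simp: less_Suc_eq)
    qed
  qed
qed

lemma simple_complete_graph: "simple_graph (complete_graph n)"
  by (auto simp: simple_graph_def complete_graph_def)

lemma simple_copies: "simple_graph G \<Longrightarrow> simple_graph (copies l G)"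
  by (auto simp: simple_graph_def copies_def card_image inj_on_def)

lemma simple_disjoint_union: "simple_graph G \<Longrightarrow> simple_graph H \<Longrightarrow> simple_graph (G \<uplus> H)"
  by (auto simp: simple_graph_def disjoint_union_def card_image)

lemma simple_complete_bipartite: "simple_graph (complete_bipartite m n)"
  by (auto simp: simple_graph_def complete_bipartite_def)

lemma adj_complete_graph: "adj (complete_graph n) i j \<longleftrightarrow> i < n \<and> j < n \<and> i \<noteq> j"
  by (auto simp: adj_def complete_graph_def doubleton_eq_iff)

lemma adj_copies: "adj (copies l G) (i, u) (j, v) \<longleftrightarrow> i = j \<and> i < l \<and> adj G u v"
proof -
  have "{(i, u), (j, v)} = Pair k ` e \<longleftrightarrow> i = k \<and> j = k \<and> {u, v} = e" for k e
  proof -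
    have "{(i, u), (j, v)} = Pair k ` e \<Longrightarrow> i = k \<and> j = k"
      by blast
    moreover have "{(k, u), (k, v)} = Pair k ` e \<longleftrightarrow> {u, v} = e"
      using inj_image_eq_iff[of "Pair k" "{u, v}" e] by (simp add: inj_def)
    ultimately show ?thesis
      by blast
  qed
  then show ?thesis
    unfolding adj_def copies_def by (simp; blast)
qed

lemma adj_disjoint_union:
  fixes G :: "'a sgraph" and H :: "'b sgraph"
  shows
  "adj (G \<uplus> H) (Inl u) (Inl v) \<longleftrightarrow> adj G u v"
  "adj (G \<uplus> H) (Inr x) (Inr y) \<longleftrightarrow> adj H x y"
  "\<not> adj (G \<uplus> H) (Inl u) (Inr x)"
proof -
  have "{Inl u :: 'a + 'b, Inl v} = Inl ` e \<longleftrightarrow> {u, v} = e"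
    and "{Inr x :: 'a + 'b, Inr y} = Inr ` e' \<longleftrightarrow> {x, y} = e'" for e e'
    using inj_image_eq_iff[of Inl "{u, v}" e] inj_image_eq_iff[of Inr "{x, y}" e'] by simp_all
  moreover have "{Inl u :: 'a + 'b, a} \<noteq> Inr ` e'" "{Inr x :: 'a + 'b, b} \<noteq> Inl ` e"
    "{b, Inr x :: 'a + 'b} \<noteq> Inl ` e" for a b e e'
    by blast+
  ultimately show "adj (G \<uplus> H) (Inl u) (Inl v) \<longleftrightarrow> adj G u v"
    "adj (G \<uplus> H) (Inr x) (Inr y) \<longleftrightarrow> adj H x y" "\<not> adj (G \<uplus> H) (Inl u) (Inr x)"
    unfolding adj_def disjoint_union_def by (simp_all add: image_iff)
qed

lemma adj_complete_bipartite:
  "adj (complete_bipartite m n) (Inl i) (Inr j) \<longleftrightarrow> i < m \<and> j < n"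
  "\<not> adj (complete_bipartite m n) (Inr i) (Inr j)"
  by (simp_all add: adj_def complete_bipartite_def doubleton_eq_iff)

lemma verts_simps:
  "verts (complete_graph n) = {..<n}"
  "verts (copies l G) = {..<l} \<times> verts G"
  "verts (G \<uplus> H) = verts G <+> verts H"
  "verts (complete_bipartite m n) = {..<m} <+> {..<n}"
  by (simp_all add: complete_graph_def copies_def disjoint_union_def complete_bipartite_def)

lemma lessThan_123: "{..<Suc 0} = {0}" "{..<2} = {0, Suc 0}" "{..<3} = {0, Suc 0, 2}"
  by (auto simp: numeral_eq_Suc lessThan_Suc)

lemmas concrete_graph_simps =
  adj_copies adj_disjoint_union adj_complete_graph adj_complete_bipartite verts_simps lessThan_123 Plus_def

lemma iso_2K2:
  assumes "simple_graph H" "verts H = {w, x, y, z}"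
    and "adjacency.induces (adj H) (verts H) w x y z True False False False False True"
  shows "H \<simeq> copies 2 (complete_graph 2)"
proof -
  let ?K = "copies 2 (complete_graph 2)"
  have K: "simple_graph ?K"
    by (intro simple_copies simple_complete_graph)
  interpret adjacency "adj ?K"
    by (rule adjacency_adj[OF K])
  show ?thesis
  proof (rule iso_if_same_pattern[OF assms K])
    show verts: "verts ?K = {(0, 0), (0, 1), (1, 0), (1, 1)}"
      by (auto simp: concrete_graph_simps)
    show "induces (verts ?K) (0, 0) (0, 1) (1, 0) (1, 1) True False False False False True"
      unfolding induces_def verts by (simp add: concrete_graph_simps)
  qed
qed

lemma iso_K2_2K1:
  assumes "simple_graph H" "verts H = {w, x, y, z}"
    and "adjacency.induces (adj H) (verts H) w x y z True False False False False False"
  shows "H \<simeq> complete_graph 2 \<uplus> copies 2 (complete_graph 1)"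
proof -
  let ?K = "complete_graph 2 \<uplus> copies 2 (complete_graph 1)"
  have K: "simple_graph ?K"
    by (intro simple_disjoint_union simple_copies simple_complete_graph)
  interpret adjacency "adj ?K"
    by (rule adjacency_adj[OF K])
  show ?thesis
  proof (rule iso_if_same_pattern[OF assms K])
    show verts: "verts ?K = {Inl 0, Inl 1, Inr (0, 0), Inr (1, 0)}"
      by (auto simp: concrete_graph_simps)
    show "induces (verts ?K) (Inl 0) (Inl 1) (Inr (0, 0)) (Inr (1, 0)) True False False False False False"
      unfolding induces_def verts by (simp add: concrete_graph_simps)
  qed
qed

lemma iso_claw:
  assumes "simple_graph H" "verts H = {w, x, y, z}"
    and "adjacency.induces (adj H) (verts H) w x y z True True True False False False"
  shows "H \<simeq> complete_bipartite 1 3"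
proof -
  let ?K = "complete_bipartite 1 3"
  have K: "simple_graph ?K"
    by (rule simple_complete_bipartite)
  interpret adjacency "adj ?K"
    by (rule adjacency_adj[OF K])
  show ?thesis
  proof (rule iso_if_same_pattern[OF assms K])
    show verts: "verts ?K = {Inl 0, Inr 0, Inr 1, Inr 2}"
      by (auto simp: concrete_graph_simps)
    show "induces (verts ?K) (Inl 0) (Inr 0) (Inr 1) (Inr 2) True True True False False False"
      unfolding induces_def verts by (simp add: concrete_graph_simps)
  qed
qed

lemma forest_no_triangle:
  assumes "forest H" "{a, b, c} \<subseteq> verts H" "adj H a b" "adj H b c"
  shows "\<not> adj H a c"
proof
  assume "adj H a c"
  interpret adjacency "adj H"
    using assms(1) adjacency_adj[of H] by (simp add: forest_def)
  have "cycle_in H [a, b, c]"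
    using assms(2-4) \<open>adj H a c\<close> irrefl sym unfolding cycle_in_def path_in_def by auto
  then show False
    using assms(1) by (auto simp: forest_def)
qed

lemma forest_no_quadrilateral:
  assumes "forest H" "{a, b, c, d} \<subseteq> verts H" "distinct [a, b, c, d]"
    and "adj H a b" "adj H b c" "adj H c d"
  shows "\<not> adj H a d"
proof
  assume "adj H a d"
  interpret adjacency "adj H"
    using assms(1) adjacency_adj[of H] by (simp add: forest_def)
  have "cycle_in H [a, b, c, d]"
    using assms(2-6) sym[OF \<open>adj H a d\<close>] unfolding cycle_in_def path_in_def by auto
  then show False
    using assms(1) by (auto simp: forest_def)
qed

text \<open>A forest on four vertices has one of six patterns, and \<open>G\<close> lacks the pattern of \<open>H\<close>. The claw is excluded
by assumption. For two of the other patterns the isomorphism type of \<open>H\<close> is recorded, because they are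
the exceptions to path-perfectness.\<close>

lemma induced_free_cases:
  assumes H: "forest H" "card (verts H) \<le> 4" "\<not> H \<simeq> complete_bipartite 1 3"
    and G: "simple_graph G" "induced_free H G"
  obtains "\<not> adjacency.has_4K1 (adj G) (verts G)"
  | "\<not> adjacency.has_P3_K1 (adj G) (verts G)"
  | "\<not> adjacency.has_P4 (adj G) (verts G)"
  | "H \<simeq> copies 2 (complete_graph 2)" "\<not> adjacency.has_2K2 (adj G) (verts G)"
  | "H \<simeq> complete_graph 2 \<uplus> copies 2 (complete_graph 1)" "\<not> adjacency.has_K2_2K1 (adj G) (verts G)"
proof -
  have simple: "simple_graph H"
    using H(1) by (simp add: forest_def)
  show ?thesis
  proof (cases "card (verts H) = 4")
    case False
    then have "card (verts H) \<le> 3"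
      using H(2) by simp
    have "\<not> induced_free H G"
      if "adjacency.has_4K1 (adj G) (verts G)" "adjacency.has_P4 (adj G) (verts G)"
      using forest_no_triangle[OF H(1)]
      by (rule small_forest_not_induced_free[OF simple \<open>card (verts H) \<le> 3\<close> _ G(1) that])
    then show ?thesis
      using G(2) that(1,3) by blast
  next
    case True
    interpret H: adjacency "adj H"
      by (rule adjacency_adj[OF simple])
    interpret G: adjacency "adj G"
      by (rule adjacency_adj[OF G(1)])
    have "finite (verts H)"
      using simple by (simp add: simple_graph_def)
    have spans: "verts H = {w, x, y, z}" if "H.induces (verts H) w x y z a b c d e f" for w x y z a b c d e f
      using that card_subset_eq[OF \<open>finite (verts H)\<close>, of "{w, x, y, z}"] True
      unfolding H.induces_def by simp
    have avoids: "\<not> G.induces (verts G) w' x' y' z' a b c d e f"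
      if "H.induces (verts H) w x y z a b c d e f" for w x y z w' x' y' z' a b c d e f
      using not_induced_free_if_same_pattern[OF simple spans[OF that] that G(1)] G(2) by blast
    have "\<not> H.has_claw (verts H)"
      using iso_claw[OF simple spans] H(3) unfolding H.has_claw_def by blast
    moreover have "H.has_4K1 (verts H) \<or> H.has_K2_2K1 (verts H) \<or> H.has_2K2 (verts H) \<or>
        H.has_P3_K1 (verts H) \<or> H.has_P4 (verts H) \<or> H.has_claw (verts H)"
      using True forest_no_triangle[OF H(1)] forest_no_quadrilateral[OF H(1)]
      by (rule H.four_vertex_forest_cases)
    ultimately consider "H.has_4K1 (verts H)" | "H.has_P3_K1 (verts H)" | "H.has_P4 (verts H)"
      | "H.has_2K2 (verts H)" | "H.has_K2_2K1 (verts H)"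
      by blast
    then show ?thesis
    proof cases
      case 1
      then show ?thesis
        using that(1) avoids unfolding H.has_4K1_def G.has_4K1_def by blast
    next
      case 2
      then show ?thesis
        using that(2) avoids unfolding H.has_P3_K1_def G.has_P3_K1_def by blast
    next
      case 3
      then show ?thesis
        using that(3) avoids unfolding H.has_P4_def G.has_P4_def by blast
    next
      case 4
      then obtain w x y z where *: "H.induces (verts H) w x y z True False False False False True"
        unfolding H.has_2K2_def by blast
      then show ?thesis
        using that(4) avoids[OF *] iso_2K2[OF simple spans[OF *] *] unfolding G.has_2K2_def by blast
    next
      case 5
      then obtain w x y z where *: "H.induces (verts H) w x y z True False False False False False"
        unfolding H.has_K2_2K1_def by blast
      then show ?thesis
        using that(5) avoids[OF *] iso_K2_2K1[OF simple spans[OF *] *] unfolding G.has_K2_2K1_def by blast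
    qed
  qed
qed

lemma chromatic_number_le_Suc:
  assumes G: "simple_graph G"
    and "\<And>k. adjacency.paths_colorable (adj G) (verts G) k \<Longrightarrow> adjacency.colorable (adj G) (verts G) (Suc k)"
  shows "\<chi> G \<le> \<r> G + 1"
  using assms(2)[of "\<r> G"] path_chromatic_le_iff[OF G order_refl, of "\<r> G"]
    chromatic_number_le_iff[OF G order_refl, of "\<r> G + 1"]
  by (simp add: induced_verts[OF G])

section \<open>Chromatic number and paths in graphs without an induced small forest\<close>

theorem theorem1p5:
  fixes H :: "'b sgraph"
  assumes "forest H"
    and "card (verts H) \<le> 4"
    and "\<not> H \<simeq> complete_bipartite 1 3"
  shows "(\<forall>G :: 'a sgraph. simple_graph G \<and> induced_free H G \<longrightarrow> \<chi> G \<le> \<r> G + 1) \<and>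
    (\<not> H \<simeq> copies 2 (complete_graph 2) \<and> \<not> H \<simeq> complete_graph 2 \<uplus> copies 2 (complete_graph 1) \<longrightarrow>
      (\<forall>G :: 'a sgraph. simple_graph G \<and> induced_free H G \<longrightarrow> path_perfect G))"
proof -
  have main: "path_perfect G \<or> \<chi> G \<le> \<r> G + 1 \<and>
      (H \<simeq> copies 2 (complete_graph 2) \<or> H \<simeq> complete_graph 2 \<uplus> copies 2 (complete_graph 1))"
    if G: "simple_graph G" "induced_free H G" for G :: "'a sgraph"
  proof -
    interpret adjacency "adj G"
      by (rule adjacency_adj[OF G(1)])
    have fin: "finite (verts G)"
      using G(1) by (simp add: simple_graph_def)
    have finS: "finite S" if "S \<subseteq> verts G" for S
      using that fin finite_subset by blast
    from induced_free_cases[OF assms G] show ?thesis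
    proof cases
      case 1
      have "path_perfect G"
        using colorable_if_4K1_free[OF finS] has_subset(1) 1 by (intro path_perfectI[OF G(1)]) blast
      then show ?thesis ..
    next
      case 2
      have "path_perfect G"
        using colorable_if_P3_K1_free[OF finS] has_subset(2) 2 by (intro path_perfectI[OF G(1)]) blast
      then show ?thesis ..
    next
      case 3
      have "path_perfect G"
        using colorable_if_P4_free[OF finS] has_subset(3) 3 by (intro path_perfectI[OF G(1)]) blast
      then show ?thesis ..
    next
      case 4
      then show ?thesis
        using chromatic_number_le_Suc[OF G(1) colorable_Suc_if_2K2_free[OF fin]] by blast
    next
      case 5
      then show ?thesis
        using chromatic_number_le_Suc[OF G(1) colorable_Suc_if_K2_2K1_free[OF fin]] by blast
    qed
  qed
  have "\<chi> G \<le> \<r> G" if "simple_graph G" "path_perfect G" for G :: "'a sgraph"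
    using that induced_verts unfolding path_perfect_def by (metis order_refl)
  then show ?thesis
    using main by (metis le_add1 order_trans)
qed

end
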